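(* Let $S$ be an ordered semigroup. Then $S$ is a nil extension of a simple and regular ordered semigroup (i.e. there is an ideal $K$ of $S$ such that $K$ is a simple and regular ordered semigroup and $S$ is a nil extension of $K$) if and only if all of the following conditions hold: (i) for all $a,b\in S$ there exists $n\in\mathbb{N}$ such that $a^{n}\in (a^{n}SbSa^{n}]$; (ii) for all $a\in S$ and $b\in Reg_\leq(S)$, $a\leq ba$ implies $a\in (aSbSa]$; (iii) for all $a\in S$ and $b\in Reg_\leq(S)$, $a\leq ab$ implies $a\in (aSbSa]$; (iv) for all $a\in S$ and $b\in Reg_\leq(S)$, $a\leq b$ implies $a\in Reg_\leq(S)$.
   Context: An ordered semigroup $(S,\cdot,\leq)$ is a (nonempty) semigroup with a partial order such that $a\leq b$ implies $xa\leq xb$ and $ax\leq bx$ for all $x\in S$. $\mathbb{N}$ is the set of positive integers. For $H\subseteq S$, $(H]=\{t\in S: t\leq h \text{ for some } h\in H\}$. A nonempty subset $I\subseteq S$ is an ideal if $SI\subseteq I$, $IS\subseteq I$ and $(I]=I$. Ideals and subsemigroups of $S$ are regarded as ordered semigroups with the induced operation and order. $S$ is simple if it has no ideal other than $S$ itself. For an ideal $I$ of $S$, $S$ is called a nil extension of $I$ if for every $a\in S$ there is $m\in\mathbb{N}$ with $a^m\in I$ (equivalently, the Rees factor ordered semigroup $S/I$ is nil). An element $a\in S$ is (ordered) regular if $a\leq axa$ for some $x\in S$; $Reg_\leq(S)$ is the set of regular elements of $S$. An ordered semigroup is regular if all its elements are regular in it. *)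

theory Defs
  imports "HOL-Algebra.Congruence"
begin

text \<open>
  Ordered semigroups are given with an explicit carrier, so that an ideal or subsemigroup \<open>K\<close>
  of \<open>S\<close>, with the induced operation and order, is \<open>S\<lparr>carrier := K\<rparr>\<close>.
\<close>

record 'a osgrp = "'a partial_object" +
  mult :: "'a \<Rightarrow> 'a \<Rightarrow> 'a"  (infixl "\<cdot>\<index>" 70)
  le :: "'a \<Rightarrow> 'a \<Rightarrow> bool"  (infix "\<preceq>\<index>" 50)

locale ordered_semigroup =
  fixes S :: "('a, 'm) osgrp_scheme" (structure)
  assumes nonempty: "carrier S \<noteq> {}"
    and closed: "\<lbrakk>a \<in> carrier S; b \<in> carrier S\<rbrakk> \<Longrightarrow> a \<cdot> b \<in> carrier S"
    and assoc: "\<lbrakk>a \<in> carrier S; b \<in> carrier S; c \<in> carrier S\<rbrakk> \<Longrightarrow> (a \<cdot> b) \<cdot> c = a \<cdot> (b \<cdot> c)"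
    and le_refl: "reflp_on (carrier S) (le S)"
    and le_trans: "transp_on (carrier S) (le S)"
    and le_antisym: "antisymp_on (carrier S) (le S)"
    and mult_left_mono:
      "\<lbrakk>a \<in> carrier S; b \<in> carrier S; x \<in> carrier S; a \<preceq> b\<rbrakk> \<Longrightarrow> x \<cdot> a \<preceq> x \<cdot> b"
    and mult_right_mono:
      "\<lbrakk>a \<in> carrier S; b \<in> carrier S; x \<in> carrier S; a \<preceq> b\<rbrakk> \<Longrightarrow> a \<cdot> x \<preceq> b \<cdot> x"

text \<open>
  The power \<open>a\<^sup>n\<close> for \<open>n \<ge> 1\<close>. There is no unit, so \<open>n = 0\<close> has no meaning (the formula
  returns \<open>a\<close>), and every use below requires \<open>n \<ge> 1\<close>.
\<close>

definition spow :: "('a, 'm) osgrp_scheme \<Rightarrow> 'a \<Rightarrow> nat \<Rightarrow> 'a" where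
  "spow S a n = ((\<lambda>x. mult S x a) ^^ (n - 1)) a"

definition sprod :: "('a, 'm) osgrp_scheme \<Rightarrow> 'a set \<Rightarrow> 'a set \<Rightarrow> 'a set"  (infixl "\<star>\<index>" 70) where
  "sprod S A B = {mult S x y | x y. x \<in> A \<and> y \<in> B}"

text \<open>The set \<open>(H] = {t \<in> S: t \<le> h for some h \<in> H}\<close>.\<close>

definition down :: "('a, 'm) osgrp_scheme \<Rightarrow> 'a set \<Rightarrow> 'a set" where
  "down S H = {t \<in> carrier S. \<exists>h\<in>H. le S t h}"

definition os_ideal :: "('a, 'm) osgrp_scheme \<Rightarrow> 'a set \<Rightarrow> bool" where
  "os_ideal S I \<longleftrightarrow> I \<noteq> {} \<and> I \<subseteq> carrier S \<and>
     sprod S (carrier S) I \<subseteq> I \<and> sprod S I (carrier S) \<subseteq> I \<and> down S I = I"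

definition os_simple :: "('a, 'm) osgrp_scheme \<Rightarrow> bool" where
  "os_simple S \<longleftrightarrow> (\<forall>I. os_ideal S I \<longrightarrow> I = carrier S)"

definition Reg :: "('a, 'm) osgrp_scheme \<Rightarrow> 'a set" where
  "Reg S = {a \<in> carrier S. \<exists>x\<in>carrier S. le S a (mult S (mult S a x) a)}"

definition os_regular :: "('a, 'm) osgrp_scheme \<Rightarrow> bool" where
  "os_regular S \<longleftrightarrow> (\<forall>a\<in>carrier S. a \<in> Reg S)"

definition nil_extension :: "('a, 'm) osgrp_scheme \<Rightarrow> 'a set \<Rightarrow> bool" where
  "nil_extension S I \<longleftrightarrow> os_ideal S I \<and> (\<forall>a\<in>carrier S. \<exists>m\<ge>1. spow S a m \<in> I)"

end

theory Submission
  imports Defs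
begin

text \<open>
  Refer to the four conditions of the theorem, in order, as (i)-(iv).

  The ideal \<open>K\<close> on the left-hand side can only be \<open>Reg S\<close>. On the one hand a regular ideal
  consists of regular elements. On the other hand, \<open>b \<preceq> b x b\<close> can be iterated to
  \<open>b \<preceq> (b x)\<^sup>n b\<close>, so if some power of \<open>b x\<close> lies in the ideal \<open>K\<close>, then so does \<open>b\<close>
  (lemma \<open>Reg_subset_nil_extension\<close>).

  Suppose that \<open>S\<close> is a nil extension of a simple regular ideal \<open>K\<close>. Given \<open>a \<in> K\<close> and
  \<open>b \<in> S\<close>, write \<open>a \<preceq> a x a\<close> with \<open>x \<in> K\<close>. Simplicity bounds \<open>x\<close> by a product that has
  \<open>b a \<in> K\<close> as an inner factor, and substitution into \<open>a x a\<close> gives \<open>a \<in> (aSbSa]\<close>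
  (lemma \<open>simple_regular_ideal_sandwich\<close>). Conditions (i)-(iii) are instances of this, since
  the element in question is in \<open>K\<close> each time; condition (iv) says that \<open>K\<close> is a down-set.

  Conversely, (i) makes some power of each element regular. Conditions (ii), (iii) and (iv) make
  \<open>Reg S\<close> absorbing on the right, absorbing on the left and down-closed: if \<open>b \<preceq> b x b\<close>, then
  \<open>b x\<close> is regular and \<open>b s \<preceq> (b x)(b s)\<close>, so that (ii) shows \<open>b s\<close> to be regular, and dually
  for \<open>s b\<close>. Hence \<open>Reg S\<close> is an ideal. It is regular as an ordered semigroup because
  \<open>a \<preceq> a x a\<close> implies \<open>a \<preceq> a (x a x) a\<close>. It is simple because \<open>a \<preceq> (a x)\<^sup>n a\<close> for every
  \<open>n\<close>, and for a suitable \<open>n\<close> condition (i) puts any prescribed \<open>b\<close> inside \<open>(a x)\<^sup>n\<close>.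
\<close>

section \<open>Powers and regular elements\<close>

lemma reduct_sel [simp]:
  fixes S :: "('a, 'm) osgrp_scheme"
  shows "mult (S\<lparr>carrier := K\<rparr>) = mult S" and "le (S\<lparr>carrier := K\<rparr>) = le S"
  by simp_all

context ordered_semigroup
begin

declare closed [simp] assoc [simp]

lemma le_self: "a \<in> carrier S \<Longrightarrow> a \<preceq> a"
  using le_refl by (simp add: reflp_on_def)

lemma le_trans': "\<lbrakk>a \<preceq> b; b \<preceq> c; a \<in> carrier S; b \<in> carrier S; c \<in> carrier S\<rbrakk> \<Longrightarrow> a \<preceq> c"
  using le_trans by (meson transp_onD)

lemma mult_sandwich_mono:
  assumes "a \<preceq> b" "a \<in> carrier S" "b \<in> carrier S" "x \<in> carrier S" "y \<in> carrier S"
  shows "x \<cdot> a \<cdot> y \<preceq> x \<cdot> b \<cdot> y"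
  using assms by (intro mult_right_mono mult_left_mono) auto

lemma spow_Suc: "n \<ge> 1 \<Longrightarrow> spow S a (Suc n) = spow S a n \<cdot> a"
  by (cases n) (auto simp: spow_def)

lemma spow_closed [simp]: "a \<in> carrier S \<Longrightarrow> spow S a n \<in> carrier S"
proof -
  assume a: "a \<in> carrier S"
  have "((\<lambda>x. x \<cdot> a) ^^ k) a \<in> carrier S" for k
    using a by (induction k) auto
  then show ?thesis by (simp add: spow_def)
qed

text \<open>Repeated substitution of \<open>e a\<close> for the last factor \<open>a\<close> of the bound.\<close>

lemma le_spow_mult:
  assumes "a \<in> carrier S" "e \<in> carrier S" "a \<preceq> e \<cdot> a" "n \<ge> 1"
  shows "a \<preceq> spow S e n \<cdot> a"
  using \<open>n \<ge> 1\<close>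
proof (induction n rule: dec_induct)
  case base
  then show ?case using assms by (simp add: spow_def)
next
  case (step n)
  have "spow S e n \<cdot> a \<preceq> spow S e n \<cdot> (e \<cdot> a)"
    using assms by (intro mult_left_mono) auto
  then show ?case
    using step assms le_trans'[of a "spow S e n \<cdot> a"] by (simp add: spow_Suc)
qed

lemma mem_down_sandwich:
  assumes "a \<in> carrier S" "b \<in> carrier S"
  shows "t \<in> down S ({a} \<star> carrier S \<star> {b} \<star> carrier S \<star> {a}) \<longleftrightarrow>
    t \<in> carrier S \<and> (\<exists>x\<in>carrier S. \<exists>y\<in>carrier S. t \<preceq> a \<cdot> x \<cdot> b \<cdot> y \<cdot> a)"
  unfolding down_def sprod_def by blast

lemma Reg_closed: "a \<in> Reg S \<Longrightarrow> a \<in> carrier S"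
  by (simp add: Reg_def)

lemma Reg_if_sandwich:
  assumes "a \<in> down S ({a} \<star> carrier S \<star> {b} \<star> carrier S \<star> {a})"
    and "a \<in> carrier S" "b \<in> carrier S"
  shows "a \<in> Reg S"
proof -
  obtain x y where "x \<in> carrier S" "y \<in> carrier S" "a \<preceq> a \<cdot> x \<cdot> b \<cdot> y \<cdot> a"
    using assms by (auto simp: mem_down_sandwich)
  then show ?thesis
    using assms by (auto simp: Reg_def intro!: bexI[of _ "x \<cdot> b \<cdot> y"])
qed

text \<open>If \<open>e \<preceq> e\<^sup>2\<close>, then \<open>e\<close> itself serves as the middle factor, as \<open>e \<preceq> e\<^sup>2 \<preceq> e\<^sup>3\<close>.\<close>

lemma Reg_if_le_square:
  assumes "e \<in> carrier S" "e \<preceq> e \<cdot> e"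
  shows "e \<in> Reg S"
proof -
  have "e \<cdot> e \<preceq> e \<cdot> e \<cdot> e"
    using assms by (intro mult_right_mono) auto
  then have "e \<preceq> e \<cdot> e \<cdot> e"
    using assms le_trans'[of e "e \<cdot> e" "e \<cdot> e \<cdot> e"] by simp
  then show ?thesis using assms by (auto simp: Reg_def)
qed

text \<open>The order analogue of the idempotents \<open>a x\<close> and \<open>x a\<close> of a regular semigroup.\<close>

lemma Reg_mult_inner:
  assumes "a \<in> carrier S" "x \<in> carrier S" "a \<preceq> a \<cdot> x \<cdot> a"
  shows "a \<cdot> x \<in> Reg S" and "x \<cdot> a \<in> Reg S"
proof -
  have "a \<cdot> x \<preceq> a \<cdot> x \<cdot> a \<cdot> x" and "x \<cdot> a \<preceq> x \<cdot> (a \<cdot> x \<cdot> a)"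
    using assms by (auto intro!: mult_right_mono mult_left_mono simp del: assoc)
  then show "a \<cdot> x \<in> Reg S" and "x \<cdot> a \<in> Reg S"
    using assms by (auto intro!: Reg_if_le_square)
qed

section \<open>Ideals and simplicity\<close>

lemma ideal_subset: "os_ideal S I \<Longrightarrow> a \<in> I \<Longrightarrow> a \<in> carrier S"
  by (auto simp: os_ideal_def)

lemma ideal_mult_left: "os_ideal S I \<Longrightarrow> s \<in> carrier S \<Longrightarrow> a \<in> I \<Longrightarrow> s \<cdot> a \<in> I"
  unfolding os_ideal_def sprod_def by blast

lemma ideal_mult_right: "os_ideal S I \<Longrightarrow> s \<in> carrier S \<Longrightarrow> a \<in> I \<Longrightarrow> a \<cdot> s \<in> I"
  unfolding os_ideal_def sprod_def by blast

lemma ideal_down: "os_ideal S I \<Longrightarrow> t \<in> carrier S \<Longrightarrow> h \<in> I \<Longrightarrow> t \<preceq> h \<Longrightarrow> t \<in> I"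
  by (auto simp: os_ideal_def down_def)

lemma ideal_ordered_semigroup:
  assumes "os_ideal S K"
  shows "ordered_semigroup (S\<lparr>carrier := K\<rparr>)"
proof
  show "carrier (S\<lparr>carrier := K\<rparr>) \<noteq> {}"
    using assms by (simp add: os_ideal_def)
  have sub: "K \<subseteq> carrier S" using assms by (simp add: os_ideal_def)
  show "reflp_on (carrier (S\<lparr>carrier := K\<rparr>)) (le (S\<lparr>carrier := K\<rparr>))"
    using le_refl sub by (auto intro: reflp_on_subset)
  show "transp_on (carrier (S\<lparr>carrier := K\<rparr>)) (le (S\<lparr>carrier := K\<rparr>))"
    using le_trans sub by (auto intro: transp_on_subset)
  show "antisymp_on (carrier (S\<lparr>carrier := K\<rparr>)) (le (S\<lparr>carrier := K\<rparr>))"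
    using le_antisym sub by (auto intro: antisymp_on_subset)
qed (use ideal_subset[OF assms] ideal_mult_left[OF assms] mult_left_mono mult_right_mono in auto)

text \<open>
  An ideal that contains \<open>b\<close> contains every product \<open>u b v\<close> and everything below it, so under
  this assumption it is the whole semigroup.
\<close>

lemma simple_if_le_products:
  assumes "\<And>a b. a \<in> carrier S \<Longrightarrow> b \<in> carrier S \<Longrightarrow>
    \<exists>u\<in>carrier S. \<exists>v\<in>carrier S. a \<preceq> u \<cdot> b \<cdot> v"
  shows "os_simple S"
  unfolding os_simple_def
proof (intro allI impI)
  fix I assume I: "os_ideal S I"
  then obtain b where b: "b \<in> I" by (auto simp: os_ideal_def)
  have "a \<in> I" if a: "a \<in> carrier S" for a
  proof -
    obtain u v where uv: "u \<in> carrier S" "v \<in> carrier S" "a \<preceq> u \<cdot> b \<cdot> v"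
      using assms a b ideal_subset[OF I] by blast
    then have "u \<cdot> b \<cdot> v \<in> I"
      using b by (intro ideal_mult_right[OF I] ideal_mult_left[OF I])
    then show ?thesis using uv a ideal_down[OF I] by blast
  qed
  then show "I = carrier S" using ideal_subset[OF I] by blast
qed

text \<open>The down-set of \<open>S c S\<close> is an ideal, so it is all of a simple \<open>S\<close>.\<close>

lemma simple_le_product:
  assumes "os_simple S" and c: "c \<in> carrier S" and x: "x \<in> carrier S"
  obtains u v where "u \<in> carrier S" "v \<in> carrier S" "x \<preceq> u \<cdot> c \<cdot> v"
proof -
  define J where "J = {t \<in> carrier S. \<exists>u\<in>carrier S. \<exists>v\<in>carrier S. t \<preceq> u \<cdot> c \<cdot> v}"
  have left: "s \<cdot> t \<in> J" if s: "s \<in> carrier S" and t: "t \<in> J" for s t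
  proof -
    obtain u v where uv: "t \<in> carrier S" "u \<in> carrier S" "v \<in> carrier S" "t \<preceq> u \<cdot> c \<cdot> v"
      using t by (auto simp: J_def)
    then have "s \<cdot> t \<preceq> s \<cdot> (u \<cdot> c \<cdot> v)" using s c by (intro mult_left_mono) auto
    then have "s \<cdot> t \<preceq> (s \<cdot> u) \<cdot> c \<cdot> v" using s c uv by simp
    then show ?thesis using s uv closed[of s t] closed[of s u] unfolding J_def by blast
  qed
  have right: "t \<cdot> s \<in> J" if s: "s \<in> carrier S" and t: "t \<in> J" for s t
  proof -
    obtain u v where uv: "t \<in> carrier S" "u \<in> carrier S" "v \<in> carrier S" "t \<preceq> u \<cdot> c \<cdot> v"
      using t by (auto simp: J_def)
    then have "t \<cdot> s \<preceq> (u \<cdot> c \<cdot> v) \<cdot> s" using s c by (intro mult_right_mono) auto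
    then have "t \<cdot> s \<preceq> u \<cdot> c \<cdot> (v \<cdot> s)" using s c uv by simp
    then show ?thesis using s uv closed[of t s] closed[of v s] unfolding J_def by blast
  qed
  have "c \<cdot> c \<cdot> c \<in> J" using c le_self[of "c \<cdot> c \<cdot> c"] closed unfolding J_def by blast
  moreover have "down S J = J"
  proof
    show "down S J \<subseteq> J"
    proof
      fix t assume "t \<in> down S J"
      then obtain h u v where h: "t \<in> carrier S" "h \<in> carrier S"
        and uv: "u \<in> carrier S" "v \<in> carrier S" and le: "t \<preceq> h" "h \<preceq> u \<cdot> c \<cdot> v"
        by (auto simp: down_def J_def)
      have "t \<preceq> u \<cdot> c \<cdot> v"
        using le by (rule le_trans') (use c h uv in auto)
      then show "t \<in> J" using h uv unfolding J_def by blast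
    qed
    show "J \<subseteq> down S J" using le_self by (auto simp: down_def J_def)
  qed
  moreover have "J \<subseteq> carrier S" by (auto simp: J_def)
  ultimately have "os_ideal S J"
    using left right unfolding os_ideal_def sprod_def by blast
  then have "x \<in> J" using assms by (simp add: os_simple_def)
  then show ?thesis using that by (auto simp: J_def)
qed

section \<open>Nil extensions of simple regular ideals\<close>

lemma simple_regular_ideal_sandwich:
  assumes K: "os_ideal S K" and simp_K: "os_simple (S\<lparr>carrier := K\<rparr>)"
    and reg: "os_regular (S\<lparr>carrier := K\<rparr>)"
    and a: "a \<in> K" and b: "b \<in> carrier S"
  shows "a \<in> down S ({a} \<star> carrier S \<star> {b} \<star> carrier S \<star> {a})"
proof -
  note inS = ideal_subset[OF K]
  obtain x where x: "x \<in> K" "a \<preceq> a \<cdot> x \<cdot> a"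
    using reg a by (auto simp: os_regular_def Reg_def)
  \<comment> \<open>The factor \<open>b\<close> need not lie in \<open>K\<close>, but \<open>b a\<close> does, so simplicity of \<open>K\<close> applies to it.\<close>
  have "b \<cdot> a \<in> K" using ideal_mult_left[OF K] a b by blast
  then obtain u v where uv: "u \<in> K" "v \<in> K" "x \<preceq> u \<cdot> (b \<cdot> a) \<cdot> v"
    using ordered_semigroup.simple_le_product[OF ideal_ordered_semigroup[OF K] simp_K, of "b \<cdot> a" x]
      x by auto
  have "a \<cdot> x \<cdot> a \<preceq> a \<cdot> (u \<cdot> (b \<cdot> a) \<cdot> v) \<cdot> a"
    using a b x uv inS by (intro mult_sandwich_mono) auto
  with x(2) have "a \<preceq> a \<cdot> (u \<cdot> (b \<cdot> a) \<cdot> v) \<cdot> a"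
    by (rule le_trans') (use a b x uv inS in auto)
  then have "a \<preceq> a \<cdot> u \<cdot> b \<cdot> (a \<cdot> v) \<cdot> a"
    using a b uv inS by simp
  moreover have "a \<cdot> v \<in> carrier S" using a uv inS by simp
  ultimately show ?thesis
    using inS[OF a] inS[OF uv(1)] b by (auto simp: mem_down_sandwich simp del: assoc)
qed

lemma Reg_subset_nil_extension:
  assumes "nil_extension S K" and b: "b \<in> Reg S"
  shows "b \<in> K"
proof -
  have K: "os_ideal S K" using assms by (simp add: nil_extension_def)
  obtain x where x: "b \<in> carrier S" "x \<in> carrier S" "b \<preceq> b \<cdot> x \<cdot> b"
    using b by (auto simp: Reg_def)
  then obtain m where m: "m \<ge> 1" "spow S (b \<cdot> x) m \<in> K"
    using assms unfolding nil_extension_def by (meson closed)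
  have "b \<preceq> spow S (b \<cdot> x) m \<cdot> b" using le_spow_mult x m by simp
  moreover have "spow S (b \<cdot> x) m \<cdot> b \<in> K" using ideal_mult_right[OF K] x m by simp
  ultimately show ?thesis using ideal_down[OF K] x by blast
qed

section \<open>The regular elements as an ideal\<close>

text \<open>
  The assumptions \<open>left_bound\<close> and \<open>right_bound\<close> are applied to products: \<open>b s\<close> is
  bounded by \<open>(b x)(b s)\<close> and \<open>s b\<close> by \<open>(s b)(x b)\<close>, where \<open>b \<preceq> b x b\<close>.
\<close>

lemma ideal_Reg:
  assumes nonempty_Reg: "Reg S \<noteq> {}"
    and left_bound: "\<And>a b. a \<in> carrier S \<Longrightarrow> b \<in> Reg S \<Longrightarrow> a \<preceq> b \<cdot> a \<Longrightarrow> a \<in> Reg S"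
    and right_bound: "\<And>a b. a \<in> carrier S \<Longrightarrow> b \<in> Reg S \<Longrightarrow> a \<preceq> a \<cdot> b \<Longrightarrow> a \<in> Reg S"
    and below: "\<And>a b. a \<in> carrier S \<Longrightarrow> b \<in> Reg S \<Longrightarrow> a \<preceq> b \<Longrightarrow> a \<in> Reg S"
  shows "os_ideal S (Reg S)"
proof -
  have absorb: "s \<cdot> b \<in> Reg S \<and> b \<cdot> s \<in> Reg S" if b: "b \<in> Reg S" and s: "s \<in> carrier S" for b s
  proof -
    obtain x where x: "b \<in> carrier S" "x \<in> carrier S" "b \<preceq> b \<cdot> x \<cdot> b"
      using b by (auto simp: Reg_def)
    have "b \<cdot> s \<preceq> (b \<cdot> x \<cdot> b) \<cdot> s" and "s \<cdot> b \<preceq> s \<cdot> (b \<cdot> x \<cdot> b)"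
      using x s by (auto intro!: mult_right_mono mult_left_mono simp del: assoc)
    then have "b \<cdot> s \<preceq> (b \<cdot> x) \<cdot> (b \<cdot> s)" and "s \<cdot> b \<preceq> (s \<cdot> b) \<cdot> (x \<cdot> b)"
      using x s by simp_all
    then show ?thesis
      using left_bound right_bound Reg_mult_inner x s closed by metis
  qed
  have "down S (Reg S) = Reg S"
    using below le_self Reg_closed unfolding down_def by blast
  then show ?thesis
    using absorb Reg_closed nonempty_Reg unfolding os_ideal_def sprod_def by auto
qed

lemma regular_ideal_Reg:
  assumes K: "os_ideal S (Reg S)"
  shows "os_regular (S\<lparr>carrier := Reg S\<rparr>)"
  unfolding os_regular_def
proof
  fix a assume "a \<in> carrier (S\<lparr>carrier := Reg S\<rparr>)"
  then have a: "a \<in> Reg S" by simp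
  then obtain x where x: "a \<in> carrier S" "x \<in> carrier S" "a \<preceq> a \<cdot> x \<cdot> a"
    by (auto simp: Reg_def)
  have "a \<cdot> x \<cdot> a \<preceq> a \<cdot> x \<cdot> (a \<cdot> x \<cdot> a)"
    using x by (intro mult_left_mono) auto
  then have "a \<preceq> a \<cdot> x \<cdot> (a \<cdot> x \<cdot> a)"
    using x le_trans'[of a "a \<cdot> x \<cdot> a" "a \<cdot> x \<cdot> (a \<cdot> x \<cdot> a)"] by simp
  then have "a \<preceq> a \<cdot> (x \<cdot> a \<cdot> x) \<cdot> a" using x by simp
  \<comment> \<open>A middle factor in \<open>Reg S\<close> is required; \<open>x a x\<close> is one, whereas \<open>x\<close> is only in \<open>S\<close>.\<close>
  moreover have "x \<cdot> a \<cdot> x \<in> Reg S"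
    using ideal_mult_right[OF K] ideal_mult_left[OF K] x a by blast
  ultimately show "a \<in> Reg (S\<lparr>carrier := Reg S\<rparr>)"
    using a by (auto simp: Reg_def[of "S\<lparr>carrier := Reg S\<rparr>"])
qed

lemma simple_ideal_Reg:
  assumes K: "os_ideal S (Reg S)"
    and power: "\<forall>a\<in>carrier S. \<forall>b\<in>carrier S. \<exists>n\<ge>1.
      spow S a n \<in> down S ({spow S a n} \<star> carrier S \<star> {b} \<star> carrier S \<star> {spow S a n})"
  shows "os_simple (S\<lparr>carrier := Reg S\<rparr>)"
proof (rule ordered_semigroup.simple_if_le_products[OF ideal_ordered_semigroup[OF K]])
  fix a b assume "a \<in> carrier (S\<lparr>carrier := Reg S\<rparr>)" "b \<in> carrier (S\<lparr>carrier := Reg S\<rparr>)"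
  then have a: "a \<in> Reg S" and b: "b \<in> carrier S" using Reg_closed by auto
  then obtain x where x: "a \<in> carrier S" "x \<in> carrier S" "a \<preceq> a \<cdot> x \<cdot> a"
    by (auto simp: Reg_def)
  then obtain n where n: "n \<ge> 1" "spow S (a \<cdot> x) n \<in> down S
      ({spow S (a \<cdot> x) n} \<star> carrier S \<star> {b} \<star> carrier S \<star> {spow S (a \<cdot> x) n})"
    using power b by (meson closed)
  define p where "p = spow S (a \<cdot> x) n"
  have p: "p \<in> carrier S" using x by (simp add: p_def)
  obtain s t where st: "s \<in> carrier S" "t \<in> carrier S" "p \<preceq> p \<cdot> s \<cdot> b \<cdot> t \<cdot> p"
    using n(2) p b by (auto simp: p_def[symmetric] mem_down_sandwich simp del: assoc)
  have pR: "p \<in> Reg S"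
    using Reg_if_sandwich[of p b] n(2) p b by (simp add: p_def)
  have "a \<preceq> p \<cdot> a"
    unfolding p_def using le_spow_mult x n by simp
  moreover have "p \<cdot> a \<preceq> (p \<cdot> s \<cdot> b \<cdot> t \<cdot> p) \<cdot> a"
    using st p x b by (intro mult_right_mono) auto
  ultimately have "a \<preceq> (p \<cdot> s \<cdot> b \<cdot> t \<cdot> p) \<cdot> a"
    by (rule le_trans') (use st p x b in auto)
  then have "a \<preceq> (p \<cdot> s) \<cdot> b \<cdot> (t \<cdot> p \<cdot> a)" using st p x b by simp
  moreover have "p \<cdot> s \<in> Reg S" "t \<cdot> p \<cdot> a \<in> Reg S"
    using ideal_mult_right[OF K] ideal_mult_left[OF K] st pR p a x closed by blast+
  ultimately show "\<exists>u\<in>carrier (S\<lparr>carrier := Reg S\<rparr>). \<exists>v\<in>carrier (S\<lparr>carrier := Reg S\<rparr>).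
      le (S\<lparr>carrier := Reg S\<rparr>) a
        (mult (S\<lparr>carrier := Reg S\<rparr>) (mult (S\<lparr>carrier := Reg S\<rparr>) u b) v)"
    by auto
qed

end

section \<open>The characterisation\<close>

theorem theorem3p2:
  fixes S :: "('a, 'm) osgrp_scheme" (structure)
  assumes "ordered_semigroup S"
  shows "(\<exists>K. os_ideal S K \<and>
            ordered_semigroup (S\<lparr>carrier := K\<rparr>) \<and>
            os_simple (S\<lparr>carrier := K\<rparr>) \<and>
            os_regular (S\<lparr>carrier := K\<rparr>) \<and>
            nil_extension S K)
    \<longleftrightarrow>
         (\<forall>a\<in>carrier S. \<forall>b\<in>carrier S. \<exists>n\<ge>1.
            spow S a n \<in> down S ({spow S a n} \<star> carrier S \<star> {b} \<star> carrier S \<star> {spow S a n})) \<and>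
         (\<forall>a\<in>carrier S. \<forall>b\<in>Reg S. a \<preceq> b \<cdot> a \<longrightarrow>
            a \<in> down S ({a} \<star> carrier S \<star> {b} \<star> carrier S \<star> {a})) \<and>
         (\<forall>a\<in>carrier S. \<forall>b\<in>Reg S. a \<preceq> a \<cdot> b \<longrightarrow>
            a \<in> down S ({a} \<star> carrier S \<star> {b} \<star> carrier S \<star> {a})) \<and>
         (\<forall>a\<in>carrier S. \<forall>b\<in>Reg S. a \<preceq> b \<longrightarrow> a \<in> Reg S)"
  (is "(\<exists>K. ?L K) \<longleftrightarrow> ?i \<and> ?ii \<and> ?iii \<and> ?iv")
proof -
  interpret ordered_semigroup S by fact
  show ?thesis
  proof (intro iffI; (elim exE conjE)?)
    fix K
    assume K: "os_ideal S K" and "os_simple (S\<lparr>carrier := K\<rparr>)" "os_regular (S\<lparr>carrier := K\<rparr>)"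
      and nil: "nil_extension S K"
    then have sandwich: "a \<in> down S ({a} \<star> carrier S \<star> {b} \<star> carrier S \<star> {a})"
      if "a \<in> K" "b \<in> carrier S" for a b
      using that by (intro simple_regular_ideal_sandwich)
    have Reg_K: "b \<in> K" if "b \<in> Reg S" for b
      using Reg_subset_nil_extension nil that .
    have K_Reg: "a \<in> Reg S" if "a \<in> K" for a
      using Reg_if_sandwich sandwich ideal_subset[OF K] that by blast
    have ?i
      using nil sandwich unfolding nil_extension_def by meson
    moreover have ?ii
      using sandwich Reg_K Reg_closed ideal_mult_right[OF K] ideal_down[OF K] by meson
    moreover have ?iii
      using sandwich Reg_K Reg_closed ideal_mult_left[OF K] ideal_down[OF K] by meson
    moreover have ?iv
      using K_Reg Reg_K ideal_down[OF K] by blast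
    ultimately show "?i \<and> ?ii \<and> ?iii \<and> ?iv" by blast
  next
    assume i: ?i and ii: ?ii and iii: ?iii and iv: ?iv
    have power: "\<forall>a\<in>carrier S. \<exists>n\<ge>1. spow S a n \<in> Reg S"
      using i Reg_if_sandwich spow_closed by meson
    have K: "os_ideal S (Reg S)"
    proof (rule ideal_Reg)
      show "Reg S \<noteq> {}" using nonempty power by blast
      fix a b assume ab: "a \<in> carrier S" "b \<in> Reg S"
      show "a \<in> Reg S" if "a \<preceq> b \<cdot> a"
        using ii ab that Reg_if_sandwich Reg_closed by blast
      show "a \<in> Reg S" if "a \<preceq> a \<cdot> b"
        using iii ab that Reg_if_sandwich Reg_closed by blast
      show "a \<in> Reg S" if "a \<preceq> b"
        using iv ab that by blast
    qed
    then have "?L (Reg S)"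
      using ideal_ordered_semigroup simple_ideal_Reg i regular_ideal_Reg power
      by (simp add: nil_extension_def)
    then show "\<exists>K. ?L K" ..
  qed
qed

end
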